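(* Let $p$ be a prime and $m\ge 1$ an integer. The total number of subgroups $N(m,m,m,m)=\sum_{b=0}^{4m}N_b(m,m,m,m)$ of the rank 4 finite abelian $p$-group $\mathbb{Z}/p^m\times\mathbb{Z}/p^m\times\mathbb{Z}/p^m\times\mathbb{Z}/p^m$ is given by a polynomial in $p$, expressed as a rational function as follows: $$N(m,m,m,m)=\frac{(p^2+p+1)^3(p^2+1)p^{4m+2}-\big((2m+3)p^3-2m-1\big)(p^3+p)(p+1)^3p^{3m}}{(p^2-1)^2(p^3-1)^2}$$ $$\qquad-\frac{4mp^4+4mp^3+7p^4+9p^3-4mp+6p^2-4m+p-1}{(p^2-1)^2(p^3-1)^2}.$$ In particular, the degree of this polynomial (in $p$) is $4m$ and its leading coefficient is $1$.
   Context: $\mathbb{Z}/p^{m}$ denotes the cyclic group of order $p^m$. $N_b(m,m,m,m)$ denotes the number of subgroups of order $p^b$ in $\mathbb{Z}/p^m\times\mathbb{Z}/p^m\times\mathbb{Z}/p^m\times\mathbb{Z}/p^m$, for $0\le b\le 4m$. *)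

theory Defs
  imports "HOL-Algebra.Elementary_Groups" "HOL-Computational_Algebra.Computational_Algebra"
begin

definition homocyclic4 :: "nat \<Rightarrow> nat \<Rightarrow> (int \<times> int \<times> int \<times> int) monoid" where
  "homocyclic4 p m =
     integer_mod_group (p ^ m) \<times>\<times> integer_mod_group (p ^ m) \<times>\<times>
     integer_mod_group (p ^ m) \<times>\<times> integer_mod_group (p ^ m)"

definition subgroups_of_order_count :: "nat \<Rightarrow> nat \<Rightarrow> nat \<Rightarrow> nat" where
  "subgroups_of_order_count p m b =
     card {H. subgroup H (homocyclic4 p m) \<and> card H = p ^ b}"

definition subgroups_count :: "nat \<Rightarrow> nat \<Rightarrow> nat" where
  "subgroups_count p m = card {H. subgroup H (homocyclic4 p m)}"

end

theory Submission
  imports Defs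
begin

text \<open>
  Write $G = (\mathbb{Z}/p^m)^4$ additively. A subgroup $H \supseteq p^{j+1} G$ is sent to
  $K = \{x \mid p x \in H\}$, which contains $p^j G$. The subgroups $H$ over a given $K$ are those
  between $p K$ and $K$ with $H \cap (K \cap p G) = p K$, that is, the subspaces of
  $K / p K \cong \mathbb{F}_p^4$ that meet $(K \cap p G) / p K$ trivially. If $|K : K \cap p G| = p^b$,
  this fixed subspace has dimension $4 - b$, so that $p^{(4 - b) k} \binom{b}{k}_p$ of the $H$ satisfy
  $|H : H \cap p G| = p^k$. Starting from $H = G$ at $j = 0$, where $b = 4$, this is a triangular linear
  recursion with polynomial coefficients. Its eigenvalues are $p^{k (4 - k)}$, that is,
  $1, p^3, p^4, p^3, 1$, which explains the shape of the closed form, with the factor $m$ due to the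
  repeated eigenvalues.
\<close>

section \<open>Subgroups meeting a fixed subgroup trivially\<close>

text \<open>The group is written multiplicatively, so multiplication by \<open>p\<close> in additive
  notation becomes the power \<open>x [^] p\<close>.\<close>

locale finite_comm_group_prime = comm_group G for G (structure) +
  fixes p :: nat
  assumes finite_carrier: "finite (carrier G)" and prime_p: "prime p"
begin

text \<open>By commutativity this product set is the subgroup generated by \<open>B\<close> and
  \<open>x\<close> whenever \<open>B\<close> is a subgroup; integer exponents give closure under
  inverses at once.\<close>

definition adjoin :: "'a set \<Rightarrow> 'a \<Rightarrow> 'a set" where
  "adjoin B x = (\<lambda>(b, i::int). b \<otimes> x [^] i) ` (B \<times> UNIV)"

primrec adjoin_list :: "'a set \<Rightarrow> 'a list \<Rightarrow> 'a set" where
  "adjoin_list B [] = B"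
| "adjoin_list B (x # xs) = adjoin_list (adjoin B x) xs"

text \<open>Each entry has to avoid the span of \<open>B\<close> and its predecessors. When the
  quotient \<open>U\<close>/\<open>B\<close> is a vector space over the field with \<open>p\<close>
  elements, this is linear independence of the images of the list there.\<close>

primrec independent_mod :: "'a set \<Rightarrow> 'a list \<Rightarrow> bool" where
  "independent_mod B [] = True"
| "independent_mod B (x # xs) = (x \<notin> B \<and> independent_mod (adjoin B x) xs)"

definition independent_lists :: "'a set \<Rightarrow> 'a set \<Rightarrow> nat \<Rightarrow> 'a list set" where
  "independent_lists B U k = {xs. set xs \<subseteq> U \<and> length xs = k \<and> independent_mod B xs}"

text \<open>The quotient \<open>U\<close>/\<open>B\<close> is a vector space over the field with
  \<open>p\<close> elements. Working with pairs of subgroups avoids forming quotients.\<close>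

definition elementary_over :: "'a set \<Rightarrow> 'a set \<Rightarrow> bool" where
  "elementary_over B U \<longleftrightarrow> subgroup B G \<and> subgroup U G \<and> B \<subseteq> U \<and> (\<forall>x\<in>U. x [^] p \<in> B)"

lemma finite_subgroup: "subgroup H G \<Longrightarrow> finite H"
  using finite_carrier finite_subset subgroup.subset by metis

lemma card_subgroup_pos: "subgroup H G \<Longrightarrow> card H > 0"
  using finite_subgroup subgroup.one_closed card_gt_0_iff by fastforce

lemma card_subgroup_dvd:
  assumes "subgroup A G" "subgroup B G" "A \<subseteq> B"
  shows "card A dvd card B"
proof -
  interpret B: group "G\<lparr>carrier := B\<rparr>"
    using assms(2) by (rule subgroup_imp_group)
  have "subgroup A (G\<lparr>carrier := B\<rparr>)"
    using assms by (simp add: subgroup_incl)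
  from B.lagrange[OF this] have "card (rcosets\<^bsub>G\<lparr>carrier := B\<rparr>\<^esub> A) * card A = card B"
    by (simp add: Coset.order_def)
  then show ?thesis by (metis dvd_triv_right)
qed

section \<open>Adjoining one element to a subgroup\<close>

lemma adjoinI: "b \<in> B \<Longrightarrow> b \<otimes> x [^] (i::int) \<in> adjoin B x"
  unfolding adjoin_def by force

lemma adjoinE:
  assumes "y \<in> adjoin B x"
  obtains b i where "b \<in> B" "y = b \<otimes> x [^] (i::int)"
  using assms unfolding adjoin_def by force

lemma adjoin_mono: "A \<subseteq> B \<Longrightarrow> adjoin A x \<subseteq> adjoin B x"
  unfolding adjoin_def by auto

lemma subset_adjoin:
  assumes "subgroup B G" "x \<in> carrier G"
  shows "B \<subseteq> adjoin B x"
proof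
  fix b assume b: "b \<in> B"
  have "b \<otimes> x [^] (0::int) \<in> adjoin B x" using b by (rule adjoinI)
  then show "b \<in> adjoin B x"
    using b assms by (simp add: subgroup.mem_carrier)
qed

lemma mem_adjoin:
  assumes "subgroup B G" "x \<in> carrier G"
  shows "x \<in> adjoin B x"
proof -
  have "\<one> \<otimes> x [^] (1::int) \<in> adjoin B x"
    using assms by (intro adjoinI subgroup.one_closed)
  then show ?thesis using assms by simp
qed

lemma adjoin_subset:
  assumes "subgroup U G" "B \<subseteq> U" "x \<in> U"
  shows "adjoin B x \<subseteq> U"
proof
  fix y assume "y \<in> adjoin B x"
  then obtain b i where "b \<in> B" "y = b \<otimes> x [^] (i::int)" by (rule adjoinE)
  then show "y \<in> U"
    using assms subgroup_int_pow_closed[OF assms(1,3)] by (auto intro: subgroup.m_closed)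
qed

lemma subgroup_adjoin:
  assumes B: "subgroup B G" and x: "x \<in> carrier G"
  shows "subgroup (adjoin B x) G"
proof (rule subgroupI)
  interpret B: subgroup B G by (rule B)
  show "adjoin B x \<subseteq> carrier G"
    using adjoin_subset[OF subgroup_self B.subset x] .
  show "adjoin B x \<noteq> {}"
    using mem_adjoin[OF B x] by blast
  fix y assume "y \<in> adjoin B x"
  then obtain b i where y: "b \<in> B" "y = b \<otimes> x [^] (i::int)" by (rule adjoinE)
  have "inv y = inv b \<otimes> x [^] (- i)"
    using y x by (simp add: inv_mult int_pow_neg)
  then show "inv y \<in> adjoin B x"
    using y by (simp add: adjoinI)
  fix z assume "z \<in> adjoin B x"
  then obtain c j where z: "c \<in> B" "z = c \<otimes> x [^] (j::int)" by (rule adjoinE)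
  have "y \<otimes> z = (b \<otimes> c) \<otimes> x [^] (i + j)"
    using y z x by (simp add: int_pow_mult m_ac)
  then show "y \<otimes> z \<in> adjoin B x"
    using y z by (simp add: adjoinI)
qed

lemma elementary_over_mid:
  assumes "elementary_over B U" "subgroup C G" "B \<subseteq> C" "C \<subseteq> U"
  shows "elementary_over C U" "elementary_over B C"
  using assms unfolding elementary_over_def by auto

lemma elementary_over_adjoin:
  assumes e: "elementary_over B U" and x: "x \<in> U"
  shows "elementary_over (adjoin B x) U"
proof -
  have B: "subgroup B G" and U: "subgroup U G" and BU: "B \<subseteq> U"
    using e by (auto simp: elementary_over_def)
  have xc: "x \<in> carrier G" using U x by (rule subgroup.mem_carrier)
  show ?thesis
    using elementary_over_mid(1)[OF e subgroup_adjoin[OF B xc] subset_adjoin[OF B xc]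
        adjoin_subset[OF U BU x]] .
qed

text \<open>The image of \<open>x\<close> in \<open>U\<close>/\<open>B\<close> has order exactly
  \<open>p\<close>: if \<open>p\<close> did not divide \<open>i\<close>, Bezout's identity would
  write \<open>x\<close> as a product of powers of \<open>x [^] p\<close> and
  \<open>x [^] i\<close>, both in \<open>B\<close>.\<close>

lemma elementary_power_mem_iff:
  assumes e: "elementary_over B U" and x: "x \<in> U" "x \<notin> B"
  shows "x [^] (i::int) \<in> B \<longleftrightarrow> int p dvd i"
proof
  have B: "subgroup B G" and U: "subgroup U G" and xp: "x [^] p \<in> B"
    using e x by (auto simp: elementary_over_def)
  have xc: "x \<in> carrier G" using U x(1) by (rule subgroup.mem_carrier)
  have xp': "x [^] int p \<in> B" using xp by (simp add: int_pow_int)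
  {
    assume "int p dvd i"
    then obtain j where "i = int p * j" by (rule dvdE)
    then have "x [^] i = (x [^] int p) [^] j" using xc by (simp add: int_pow_pow)
    then show "x [^] i \<in> B" using subgroup_int_pow_closed[OF B xp'] by simp
  next
    assume xi: "x [^] i \<in> B"
    show "int p dvd i"
    proof (rule ccontr)
      assume "\<not> int p dvd i"
      then have "coprime (int p) i"
        using prime_p by (simp add: prime_imp_coprime)
      then obtain u v where uv: "u * int p + v * i = 1"
        by (metis bezout_int coprime_iff_gcd_eq_1)
      have "x = x [^] (int p * u + i * v)"
        using uv xc by (simp add: mult.commute)
      also have "\<dots> = (x [^] int p) [^] u \<otimes> (x [^] i) [^] v"
        using xc by (simp add: int_pow_mult int_pow_pow)
      also have "\<dots> \<in> B"
        using subgroup_int_pow_closed[OF B] xp' xi B by (simp add: subgroup.m_closed)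
      finally show False using x(2) by simp
    qed
  }
qed

text \<open>Since \<open>x\<close> has order \<open>p\<close> modulo \<open>B\<close>, the enlarged
  subgroup is the disjoint union of the \<open>p\<close> cosets of \<open>B\<close> given by the
  powers of \<open>x\<close> with exponent from 0 to \<open>p - 1\<close>.\<close>

lemma card_adjoin:
  assumes e: "elementary_over B U" and x: "x \<in> U" "x \<notin> B"
  shows "card (adjoin B x) = p * card B"
proof -
  have B: "subgroup B G" and U: "subgroup U G"
    using e by (auto simp: elementary_over_def)
  interpret B: subgroup B G by (rule B)
  have xc: "x \<in> carrier G" using U x(1) by (rule subgroup.mem_carrier)
  have p0: "p > 0" using prime_p by (simp add: prime_gt_0_nat)
  let ?f = "\<lambda>(b, i::int). b \<otimes> x [^] i"
  have inj: "inj_on ?f (B \<times> {0..<int p})"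
  proof (rule inj_onI, clarify)
    fix b i c j
    assume b: "b \<in> B" and c: "c \<in> B" and i: "i \<in> {0..<int p}" and j: "j \<in> {0..<int p}"
      and eq: "b \<otimes> x [^] i = c \<otimes> x [^] j"
    have "x [^] (i - j) = inv b \<otimes> (b \<otimes> x [^] i) \<otimes> inv (x [^] j)"
      using b xc by (simp add: int_pow_diff m_assoc[symmetric])
    also have "\<dots> = inv b \<otimes> c"
      unfolding eq using b c xc by (simp add: m_assoc)
    also have "\<dots> \<in> B" using b c by simp
    finally have "int p dvd i - j"
      using elementary_power_mem_iff[OF e x] by simp
    then have "i = j"
      using i j by (metis atLeastLessThan_iff mod_eq_dvd_iff mod_pos_pos_trivial)
    then show "b = c \<and> i = j" using eq b c xc by simp
  qed
  have "adjoin B x = ?f ` (B \<times> {0..<int p})"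
  proof (intro equalityI subsetI)
    fix y assume "y \<in> adjoin B x"
    then obtain b i where y: "b \<in> B" "y = b \<otimes> x [^] (i::int)" by (rule adjoinE)
    \<comment> \<open>Division with remainder: the part of the exponent divisible by
      \<open>p\<close> is absorbed into \<open>B\<close>.\<close>
    define c where "c = b \<otimes> x [^] (int p * (i div int p))"
    have "c \<in> B"
      unfolding c_def using y elementary_power_mem_iff[OF e x] by simp
    moreover have "y = c \<otimes> x [^] (i mod int p)"
    proof -
      have "x [^] i = x [^] (int p * (i div int p) + i mod int p)" by simp
      also have "\<dots> = x [^] (int p * (i div int p)) \<otimes> x [^] (i mod int p)"
        using xc by (simp only: int_pow_mult)
      finally show ?thesis using y xc by (simp add: c_def m_assoc)
    qed
    moreover have "i mod int p \<in> {0..<int p}" using p0 by simp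
    ultimately show "y \<in> ?f ` (B \<times> {0..<int p})" by force
  next
    fix y assume "y \<in> ?f ` (B \<times> {0..<int p})"
    then show "y \<in> adjoin B x" by (auto intro: adjoinI)
  qed
  then show ?thesis
    using card_image[OF inj] by (simp add: card_cartesian_product mult.commute)
qed

section \<open>Spans of lists and linear independence\<close>

lemma adjoin_list_subgroup:
  assumes "elementary_over B U" "set xs \<subseteq> U"
  shows "subgroup (adjoin_list B xs) G" "B \<subseteq> adjoin_list B xs" "adjoin_list B xs \<subseteq> U"
    "set xs \<subseteq> adjoin_list B xs"
proof -
  have "subgroup (adjoin_list B xs) G \<and> B \<subseteq> adjoin_list B xs \<and> adjoin_list B xs \<subseteq> U \<and>
    set xs \<subseteq> adjoin_list B xs"
    using assms
  proof (induction xs arbitrary: B)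
    case Nil
    then show ?case by (simp add: elementary_over_def)
  next
    case (Cons x xs)
    have B: "subgroup B G" and U: "subgroup U G"
      using Cons.prems by (auto simp: elementary_over_def)
    have xc: "x \<in> carrier G" using U Cons.prems by (auto intro: subgroup.mem_carrier)
    have "elementary_over (adjoin B x) U"
      using Cons.prems by (simp add: elementary_over_adjoin)
    from Cons.IH[OF this] show ?case
      using Cons.prems subset_adjoin[OF B xc] mem_adjoin[OF B xc] by auto
  qed
  then show "subgroup (adjoin_list B xs) G" "B \<subseteq> adjoin_list B xs" "adjoin_list B xs \<subseteq> U"
    "set xs \<subseteq> adjoin_list B xs" by auto
qed

lemma card_adjoin_list:
  assumes "elementary_over B U" "set xs \<subseteq> U" "independent_mod B xs"
  shows "card (adjoin_list B xs) = p ^ length xs * card B"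
  using assms
proof (induction xs arbitrary: B)
  case (Cons x xs)
  then show ?case
    using elementary_over_adjoin card_adjoin by simp
qed simp

lemma independent_mod_antimono:
  "A \<subseteq> B \<Longrightarrow> independent_mod B xs \<Longrightarrow> independent_mod A xs"
proof (induction xs arbitrary: A B)
  case (Cons x xs)
  then show ?case
    using Cons.IH[OF adjoin_mono[OF Cons.prems(1)]] by auto
qed simp

text \<open>Vectors independent modulo the larger \<open>Y\<close> span over \<open>A\<close> a
  space that meets \<open>Y\<close> only in \<open>A\<close>. The induction adjoins the head to both
  \<open>A\<close> and \<open>Y\<close>.\<close>

lemma adjoin_list_Int:
  assumes "elementary_over A U" "elementary_over Y U" "A \<subseteq> Y" "set xs \<subseteq> U"
    "independent_mod Y xs"
  shows "adjoin_list A xs \<inter> Y = A"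
  using assms
proof (induction xs arbitrary: A Y)
  case Nil
  then show ?case by auto
next
  case (Cons x xs)
  have A: "subgroup A G" and U: "subgroup U G" and Y: "subgroup Y G"
    using Cons.prems by (auto simp: elementary_over_def)
  have x: "x \<in> U" "x \<notin> Y" "x \<notin> A" using Cons.prems by auto
  have xc: "x \<in> carrier G" using U x(1) by (rule subgroup.mem_carrier)
  have IH: "adjoin_list (adjoin A x) xs \<inter> adjoin Y x = adjoin A x"
    using Cons.prems x by (intro Cons.IH elementary_over_adjoin adjoin_mono) auto
  \<comment> \<open>If a product of an element of \<open>A\<close> and \<open>x [^] i\<close> lies
    in \<open>Y\<close>, so does \<open>x [^] i\<close>. As \<open>x\<close> has order
    \<open>p\<close> modulo both subgroups, \<open>p\<close> divides \<open>i\<close>, which puts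
    the power into \<open>A\<close>.\<close>
  have "adjoin A x \<inter> Y \<subseteq> A"
  proof
    fix y assume y: "y \<in> adjoin A x \<inter> Y"
    then obtain a i where a: "a \<in> A" "y = a \<otimes> x [^] (i::int)" by (auto elim: adjoinE)
    have ac: "a \<in> carrier G" "inv a \<in> Y"
      using a A Y Cons.prems(3) by (auto intro: subgroup.mem_carrier subgroup.m_inv_closed)
    have "x [^] i = inv a \<otimes> y"
      using a ac xc by (simp add: m_assoc[symmetric])
    also have "\<dots> \<in> Y" using ac y Y by (simp add: subgroup.m_closed)
    finally have "x [^] i \<in> A"
      using elementary_power_mem_iff[OF Cons.prems(2) x(1,2)]
        elementary_power_mem_iff[OF Cons.prems(1) x(1,3)] by simp
    then show "y \<in> A" using a A by (simp add: subgroup.m_closed)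
  qed
  moreover have "A \<subseteq> adjoin_list (adjoin A x) xs"
    using adjoin_list_subgroup(2)[OF Cons.prems(1,4)] by simp
  ultimately show ?case
    using IH subset_adjoin[OF Y xc] Cons.prems(3) by auto
qed

text \<open>As \<open>X \<inter> Y = A\<close>, the quotient \<open>X\<close>/\<open>A\<close>
  embeds into the quotient by \<open>Y\<close>, so independence survives the passage from
  \<open>A\<close> to \<open>Y\<close>. The induction keeps \<open>X\<close> fixed and adjoins the
  head to both \<open>A\<close> and \<open>Y\<close>.\<close>

lemma independent_mod_larger:
  assumes "subgroup Y G" "subgroup X G" "X \<inter> Y = A" "set xs \<subseteq> X" "independent_mod A xs"
  shows "independent_mod Y xs"
  using assms
proof (induction xs arbitrary: A Y)
  case (Cons x xs)
  have x: "x \<in> X" "x \<notin> Y" using Cons.prems by auto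
  then have xc: "x \<in> carrier G" using Cons.prems(2) by (auto intro: subgroup.mem_carrier)
  \<comment> \<open>This is Dedekind's modular law, applicable because \<open>x\<close> lies in
    \<open>X\<close>.\<close>
  have "X \<inter> adjoin Y x = adjoin A x"
  proof
    show "adjoin A x \<subseteq> X \<inter> adjoin Y x"
      using adjoin_subset[OF Cons.prems(2), of A x] adjoin_mono[of A Y x] x Cons.prems(3) by auto
    show "X \<inter> adjoin Y x \<subseteq> adjoin A x"
    proof
      fix z assume z: "z \<in> X \<inter> adjoin Y x"
      then obtain y i where y: "y \<in> Y" "z = y \<otimes> x [^] (i::int)" by (auto elim: adjoinE)
      have yc: "y \<in> carrier G" using y Cons.prems(1) by (auto intro: subgroup.mem_carrier)
      have "y = z \<otimes> x [^] (- i)"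
        using y yc xc by (simp add: int_pow_neg m_assoc)
      also have "\<dots> \<in> X"
        using z subgroup_int_pow_closed[OF Cons.prems(2) x(1)] Cons.prems(2)
        by (simp add: subgroup.m_closed)
      finally have "y \<in> A" using y Cons.prems(3) by auto
      then show "z \<in> adjoin A x" using y by (simp add: adjoinI)
    qed
  qed
  then show ?case
    using Cons.IH[OF subgroup_adjoin[OF Cons.prems(1) xc] Cons.prems(2)] Cons.prems x by auto
qed simp

text \<open>The head is any element of \<open>U - B\<close>, and the tail is independent modulo a
  subgroup \<open>p\<close> times as large. If \<open>k\<close> exceeds the dimension of
  \<open>U\<close>/\<open>B\<close>, a factor of the product is zero, as it should be.\<close>

lemma card_independent_lists:
  assumes "elementary_over B U"
  shows "card (independent_lists B U k) = (\<Prod>i<k. card U - p ^ i * card B)"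
  using assms
proof (induction k arbitrary: B)
  case 0
  have "independent_lists B U 0 = {[]}" by (auto simp: independent_lists_def)
  then show ?case by simp
next
  case (Suc k)
  have B: "subgroup B G" and U: "subgroup U G" and BU: "B \<subseteq> U"
    using Suc.prems by (auto simp: elementary_over_def)
  have finU: "finite U" using U by (rule finite_subgroup)
  have eq: "independent_lists B U (Suc k) =
      (\<Union>x\<in>U - B. (#) x ` independent_lists (adjoin B x) U k)"
  proof (intro equalityI subsetI)
    fix ys assume "ys \<in> independent_lists B U (Suc k)"
    then obtain x xs where "ys = x # xs" "x \<in> U - B" "xs \<in> independent_lists (adjoin B x) U k"
      by (cases ys) (auto simp: independent_lists_def)
    then show "ys \<in> (\<Union>x\<in>U - B. (#) x ` independent_lists (adjoin B x) U k)" by blast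
  qed (auto simp: independent_lists_def)
  have fin: "finite (independent_lists C U k)" for C
    by (rule finite_subset[OF _ finite_lists_length_eq[OF finU, of k]])
      (auto simp: independent_lists_def)
  have "card (independent_lists B U (Suc k)) =
      (\<Sum>x\<in>U - B. card ((#) x ` independent_lists (adjoin B x) U k))"
    unfolding eq using finU fin by (intro card_UN_disjoint) auto
  also have "\<dots> = (\<Sum>x\<in>U - B. \<Prod>i<k. card U - p ^ i * (p * card B))"
  proof (rule sum.cong[OF refl])
    fix x assume x: "x \<in> U - B"
    have "card ((#) x ` independent_lists (adjoin B x) U k) = card (independent_lists (adjoin B x) U k)"
      by (rule card_image) simp
    also have "\<dots> = (\<Prod>i<k. card U - p ^ i * (p * card B))"
      using x Suc.IH[OF elementary_over_adjoin[OF Suc.prems]] card_adjoin[OF Suc.prems] by simp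
    finally show "card ((#) x ` independent_lists (adjoin B x) U k) =
        (\<Prod>i<k. card U - p ^ i * (p * card B))" .
  qed
  also have "\<dots> = (card U - card B) * (\<Prod>i<k. card U - p ^ Suc i * card B)"
    using BU finU by (simp add: card_Diff_subset finite_subset mult.assoc mult.left_commute)
  also have "\<dots> = (\<Prod>i<Suc k. card U - p ^ i * card B)"
    by (simp add: prod.lessThan_Suc_shift del: prod.lessThan_Suc)
  finally show ?case .
qed

text \<open>For \<open>U\<close>/\<open>A\<close> elementary abelian, these are the
  \<open>k\<close>-dimensional subspaces of \<open>U\<close>/\<open>A\<close> with zero intersection
  with \<open>Y\<close>/\<open>A\<close>.\<close>

definition trivial_meet_subgroups :: "'a set \<Rightarrow> 'a set \<Rightarrow> 'a set \<Rightarrow> nat \<Rightarrow> 'a set set" where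
  "trivial_meet_subgroups A Y U k =
     {X. subgroup X G \<and> A \<subseteq> X \<and> X \<subseteq> U \<and> X \<inter> Y = A \<and> card X = p ^ k * card A}"

text \<open>
  Lists in \<open>U\<close> that are independent modulo \<open>Y\<close> are counted twice: directly, and by the subgroup
  that they span over \<open>A\<close>.
\<close>

lemma card_trivial_meet_subgroups:
  assumes eA: "elementary_over A U" and eY: "elementary_over Y U" and AY: "A \<subseteq> Y"
  shows "card (trivial_meet_subgroups A Y U k) * (\<Prod>i<k. p ^ k * card A - p ^ i * card A) =
    (\<Prod>i<k. card U - p ^ i * card Y)"
proof -
  let ?N = "trivial_meet_subgroups A Y U k" and ?T = "independent_lists Y U k"
  have A: "subgroup A G" and U: "subgroup U G" and Y: "subgroup Y G" and YU: "Y \<subseteq> U"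
    using eA eY by (auto simp: elementary_over_def)
  have finU: "finite U" using U by (rule finite_subgroup)
  have finT: "finite ?T"
    by (rule finite_subset[OF _ finite_lists_length_eq[OF finU, of k]])
      (auto simp: independent_lists_def)
  have finN: "finite ?N"
    by (rule finite_subset[of _ "Pow U"]) (auto simp: trivial_meet_subgroups_def finU)
  have sub: "adjoin_list A ` ?T \<subseteq> ?N"
  proof clarify
    fix xs assume xs: "xs \<in> ?T"
    then have i: "independent_mod Y xs" "independent_mod A xs" "set xs \<subseteq> U" "length xs = k"
      using independent_mod_antimono[OF AY] by (auto simp: independent_lists_def)
    show "adjoin_list A xs \<in> ?N"
      using adjoin_list_subgroup[OF eA i(3)] card_adjoin_list[OF eA i(3,2)]
        adjoin_list_Int[OF eA eY AY i(3,1)] i(4)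
      by (simp add: trivial_meet_subgroups_def)
  qed
  \<comment> \<open>The lists that span a given \<open>X\<close> are the ordered bases of
    \<open>X\<close>/\<open>A\<close>; their number depends only on \<open>k\<close> and
    \<open>card A\<close>.\<close>
  have fibre: "{xs \<in> ?T. adjoin_list A xs = X} = independent_lists A X k" if X: "X \<in> ?N" for X
  proof -
    have X': "subgroup X G" "A \<subseteq> X" "X \<subseteq> U" "X \<inter> Y = A" "card X = p ^ k * card A"
      using X by (auto simp: trivial_meet_subgroups_def)
    have eX: "elementary_over A X" using elementary_over_mid(2)[OF eA X'(1-3)] .
    show ?thesis
    proof (intro equalityI subsetI)
      fix xs assume "xs \<in> {xs \<in> ?T. adjoin_list A xs = X}"
      then show "xs \<in> independent_lists A X k"
        using adjoin_list_subgroup(4)[OF eA] independent_mod_antimono[OF AY]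
        by (auto simp: independent_lists_def)
    next
      fix xs assume "xs \<in> independent_lists A X k"
      then have xs: "set xs \<subseteq> X" "length xs = k" "independent_mod A xs"
        by (auto simp: independent_lists_def)
      have "adjoin_list A xs = X"
        using adjoin_list_subgroup(3)[OF eX xs(1)] card_adjoin_list[OF eX xs(1,3)] xs(2) X'(5)
          finite_subgroup[OF X'(1)] by (intro card_subset_eq) auto
      then show "xs \<in> {xs \<in> ?T. adjoin_list A xs = X}"
        using independent_mod_larger[OF Y X'(1,4) xs(1,3)] xs X'(3)
        by (auto simp: independent_lists_def)
    qed
  qed
  have "card ?T = (\<Sum>X\<in>?N. card {xs \<in> ?T. adjoin_list A xs = X})"
    using sum.group[OF finT finN sub, of "\<lambda>_. 1::nat"] by simp
  also have "\<dots> = (\<Sum>X\<in>?N. \<Prod>i<k. p ^ k * card A - p ^ i * card A)"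
  proof (rule sum.cong[OF refl])
    fix X assume X: "X \<in> ?N"
    then have "elementary_over A X" "card X = p ^ k * card A"
      using elementary_over_mid(2)[OF eA] by (auto simp: trivial_meet_subgroups_def)
    then show "card {xs \<in> ?T. adjoin_list A xs = X} = (\<Prod>i<k. p ^ k * card A - p ^ i * card A)"
      using card_independent_lists fibre[OF X] by simp
  qed
  finally show ?thesis
    using card_independent_lists[OF eY] by simp
qed

end

section \<open>Recursion for the number of subgroups\<close>

text \<open>The Gaussian binomial coefficient, defined by the \<open>q\<close>-Pascal rule without
  division: for a prime power \<open>q\<close> it counts the \<open>k\<close>-dimensional subspaces
  of an \<open>n\<close>-dimensional space over the field with \<open>q\<close> elements.\<close>

fun gauss_binomial :: "'a::comm_semiring_1 \<Rightarrow> nat \<Rightarrow> nat \<Rightarrow> 'a" where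
  "gauss_binomial q n 0 = 1"
| "gauss_binomial q 0 (Suc k) = 0"
| "gauss_binomial q (Suc n) (Suc k) = gauss_binomial q n k + q ^ Suc k * gauss_binomial q n (Suc k)"

text \<open>This is the usual quotient formula cleared of denominators; for \<open>k > n\<close> the
  right-hand side has a zero factor at \<open>i = n\<close>.\<close>

lemma gauss_binomial_prod:
  fixes q :: "'a::comm_ring_1"
  shows "gauss_binomial q n k * (\<Prod>i<k. q ^ k - q ^ i) = (\<Prod>i<k. q ^ n - q ^ i)"
proof (induction n arbitrary: k)
  case 0
  then show ?case
    by (cases k) (simp_all add: prod.lessThan_Suc_shift del: prod.lessThan_Suc)
next
  case (Suc n)
  show ?case
  proof (cases k)
    case (Suc l)
    define P where "P n k = (\<Prod>i<k. q ^ n - q ^ i)" for n k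
    \<comment> \<open>Split off the factor at \<open>i = 0\<close> and take \<open>q\<close> out of
      each of the others.\<close>
    have step: "P (Suc n) (Suc l) = (q ^ Suc n - 1) * q ^ l * P n l" for n l
    proof -
      have "P (Suc n) (Suc l) = (q ^ Suc n - 1) * (\<Prod>i<l. q * (q ^ n - q ^ i))"
        unfolding P_def prod.lessThan_Suc_shift by (simp add: algebra_simps)
      then show ?thesis by (simp add: P_def prod.distrib mult.assoc)
    qed
    have IH: "gauss_binomial q n k * P k k = P n k" for k
      using Suc.IH by (simp add: P_def)
    have last: "P n (Suc l) = P n l * (q ^ n - q ^ l)"
      by (simp add: P_def)
    have "gauss_binomial q (Suc n) (Suc l) * P (Suc l) (Suc l) =
        (q ^ Suc l - 1) * q ^ l * (gauss_binomial q n l * P l l) +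
        q ^ Suc l * (gauss_binomial q n (Suc l) * P (Suc l) (Suc l))"
      by (simp add: step algebra_simps)
    also have "\<dots> = (q ^ Suc l - 1) * q ^ l * P n l + q ^ Suc l * (P n l * (q ^ n - q ^ l))"
      unfolding IH last ..
    also have "\<dots> = P (Suc n) (Suc l)"
      by (simp add: step algebra_simps)
    finally show ?thesis using Suc by (simp add: P_def)
  qed simp
qed

lemma of_nat_gauss_binomial:
  "of_nat (gauss_binomial q n k) = gauss_binomial (of_nat q :: 'a::comm_semiring_1) n k"
  by (induction q n k rule: gauss_binomial.induct) simp_all

lemma poly_gauss_binomial:
  "poly (gauss_binomial q n k) x = gauss_binomial (poly q x :: 'a::comm_ring_1) n k"
  by (induction q n k rule: gauss_binomial.induct) simp_all

text \<open>One recursion over an arbitrary commutative semiring serves three purposes: the count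
  itself at a natural number, the closed form at a real number, and the degree at the polynomial
  indeterminate.\<close>

primrec rank_count :: "nat \<Rightarrow> 'a::comm_semiring_1 \<Rightarrow> nat \<Rightarrow> nat \<Rightarrow> 'a" where
  "rank_count r q 0 k = (if k = r then 1 else 0)"
| "rank_count r q (Suc j) k =
    (\<Sum>b\<le>r. rank_count r q j b * (q ^ ((r - b) * k) * gauss_binomial q b k))"

lemma of_nat_rank_count:
  "of_nat (rank_count r q j k) = rank_count r (of_nat q :: 'a::comm_semiring_1) j k"
  by (induction j arbitrary: k) (simp_all add: of_nat_gauss_binomial)

lemma poly_rank_count:
  "poly (rank_count r q j k) x = rank_count r (poly q x :: 'a::comm_ring_1) j k"
  by (induction j arbitrary: k) (simp_all add: poly_sum poly_gauss_binomial)

text \<open>For \<open>e > 0\<close> the three properties characterise the direct product of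
  \<open>r\<close> cyclic groups of order \<open>p ^ e\<close>. In this form they pass directly to
  direct products.\<close>

locale homocyclic_group = finite_comm_group_prime +
  fixes e r :: nat
  assumes exponent: "x \<in> carrier G \<Longrightarrow> x [^] (p ^ e) = \<one>"
    and card_torsion: "card {x \<in> carrier G. x [^] p = \<one>} = p ^ r"
    and torsion_divisible: "x \<in> carrier G \<Longrightarrow> x [^] p = \<one> \<Longrightarrow> \<exists>y\<in>carrier G. x = y [^] (p ^ (e - 1))"
begin

section \<open>The p-th power map and the layers of subgroups\<close>

definition power_image :: "'a set \<Rightarrow> 'a set" where
  "power_image K = (\<lambda>x. x [^] p) ` K"

definition power_preimage :: "'a set \<Rightarrow> 'a set" where
  "power_preimage H = {x \<in> carrier G. x [^] p \<in> H}"

text \<open>The layers grow from the whole group alone at \<open>j = 0\<close> to all subgroups at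
  \<open>j = e\<close>.\<close>

definition layer :: "nat \<Rightarrow> 'a set set" where
  "layer j = {H. subgroup H G \<and> (\<forall>x\<in>carrier G. x [^] (p ^ j) \<in> H)}"

text \<open>The rank \<open>k\<close> is the exponent of the index of
  \<open>H \<inter> power_image (carrier G)\<close> in \<open>H\<close>, stated by
  cardinalities.\<close>

definition layer_rank :: "nat \<Rightarrow> nat \<Rightarrow> 'a set set" where
  "layer_rank j k = {H \<in> layer j. card H = p ^ k * card (H \<inter> power_image (carrier G))}"

lemma p_gt_1: "p > 1"
  using prime_p by (rule prime_gt_1_nat)

lemma subgroup_nat_pow_closed: "subgroup H G \<Longrightarrow> x \<in> H \<Longrightarrow> x [^] (n::nat) \<in> H"
  using subgroup_int_pow_closed[of H x "int n"] by (simp add: int_pow_int)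

lemma subgroup_power_image:
  assumes K: "subgroup K G"
  shows "subgroup (power_image K) G" "power_image K \<subseteq> K"
proof -
  interpret K: subgroup K G by (rule K)
  show "power_image K \<subseteq> K"
    using subgroup_nat_pow_closed[OF K] by (auto simp: power_image_def)
  show "subgroup (power_image K) G"
  proof (rule subgroupI)
    fix a b assume "a \<in> power_image K" "b \<in> power_image K"
    then obtain x y where xy: "x \<in> K" "y \<in> K" "a = x [^] p" "b = y [^] p"
      by (auto simp: power_image_def)
    then have "a \<otimes> b = (x \<otimes> y) [^] p" "inv a = (inv x) [^] p"
      by (simp_all add: nat_pow_distrib nat_pow_inv)
    then show "a \<otimes> b \<in> power_image K" "inv a \<in> power_image K"
      using xy by (auto simp: power_image_def)
  qed (auto simp: power_image_def intro: K.one_closed)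
qed

lemma subgroup_power_preimage:
  assumes H: "subgroup H G"
  shows "subgroup (power_preimage H) G"
proof -
  interpret H: subgroup H G by (rule H)
  have "\<one> \<in> power_preimage H" by (simp add: power_preimage_def)
  then show ?thesis
    by (intro subgroupI) (auto simp: power_preimage_def nat_pow_distrib nat_pow_inv)
qed

text \<open>The intersection thus depends on \<open>H\<close> only through its preimage, so it is
  known once the preimage is fixed.\<close>

lemma Int_power_image: "H \<inter> power_image (carrier G) = power_image (power_preimage H)"
  by (auto simp: power_image_def power_preimage_def)

lemma power_preimage_layer:
  assumes "H \<in> layer (Suc j)"
  shows "power_preimage H \<in> layer j"
  using assms subgroup_power_preimage
  by (auto simp: layer_def power_preimage_def nat_pow_pow mult.commute)

text \<open>An element of order dividing \<open>p\<close> is a power with exponent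
  \<open>p ^ (e - 1)\<close>, hence also one with exponent \<open>p ^ j\<close> because
  \<open>j < e\<close>; members of the layer contain all of these.\<close>

lemma torsion_subset_layer:
  assumes K: "K \<in> layer j" and j: "j < e" and x: "x \<in> carrier G" "x [^] p = \<one>"
  shows "x \<in> K"
proof -
  obtain y where y: "y \<in> carrier G" "x = y [^] (p ^ (e - 1))"
    using torsion_divisible[OF x] by blast
  have "x = (y [^] (p ^ (e - 1 - j))) [^] (p ^ j)"
    using y j by (simp add: nat_pow_pow flip: power_add)
  then show ?thesis using K y by (simp add: layer_def)
qed

text \<open>The p-th power map on \<open>K\<close> has the full \<open>p\<close>-torsion as its
  kernel, as \<open>K\<close> contains it, so every fibre is a coset of size \<open>p ^ r\<close>.
  The quotient of \<open>K\<close> by its p-th powers therefore has dimension \<open>r\<close> for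
  every such \<open>K\<close>.\<close>

lemma card_power_image:
  assumes K: "K \<in> layer j" and j: "j < e"
  shows "card K = p ^ r * card (power_image K)"
proof -
  let ?V = "{x \<in> carrier G. x [^] p = \<one>}"
  have subK: "subgroup K G" using K by (simp add: layer_def)
  interpret K: subgroup K G by (rule subK)
  have finK: "finite K" using subK by (rule finite_subgroup)
  have fib: "card {x \<in> K. x [^] p = y} = p ^ r" if y: "y \<in> power_image K" for y
  proof -
    obtain a where a: "a \<in> K" "y = a [^] p" using y by (auto simp: power_image_def)
    have "{x \<in> K. x [^] p = y} = (\<lambda>v. a \<otimes> v) ` ?V"
    proof (intro equalityI subsetI)
      fix x assume x: "x \<in> {x \<in> K. x [^] p = y}"
      have "(inv a \<otimes> x) [^] p = \<one>"
        using x a by (simp add: nat_pow_distrib nat_pow_inv)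
      then have "inv a \<otimes> x \<in> ?V" using x a by simp
      moreover have "x = a \<otimes> (inv a \<otimes> x)" using x a by (simp add: m_assoc[symmetric])
      ultimately show "x \<in> (\<lambda>v. a \<otimes> v) ` ?V" by blast
    next
      fix x assume "x \<in> (\<lambda>v. a \<otimes> v) ` ?V"
      then show "x \<in> {x \<in> K. x [^] p = y}"
        using a torsion_subset_layer[OF K j] by (auto simp: nat_pow_distrib)
    qed
    moreover have "inj_on (\<lambda>v. a \<otimes> v) ?V" using a by (auto intro: inj_onI)
    ultimately show ?thesis using card_torsion by (simp add: card_image)
  qed
  have "card K = (\<Sum>y\<in>power_image K. card {x \<in> K. x [^] p = y})"
    using sum.group[of K "power_image K" "\<lambda>x. x [^] p" "\<lambda>_. 1::nat"] finK
    by (simp add: power_image_def)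
  then show ?thesis using fib by simp
qed

text \<open>
  A subgroup \<open>H\<close> with preimage \<open>K\<close> lies between \<open>p K\<close> and \<open>K\<close> (additively written), because
  \<open>H \<inter> p G = p K\<close>; conversely this equation determines the preimage, since \<open>K\<close> contains the
  \<open>p\<close>-torsion.
\<close>

lemma layer_rank_fibre:
  assumes K: "K \<in> layer j" and j: "j < e"
  shows "{H \<in> layer_rank (Suc j) k. power_preimage H = K} =
    trivial_meet_subgroups (power_image K) (K \<inter> power_image (carrier G)) K k"
proof (intro equalityI subsetI)
  fix H assume "H \<in> {H \<in> layer_rank (Suc j) k. power_preimage H = K}"
  then have H: "subgroup H G" "power_preimage H = K"
      "card H = p ^ k * card (H \<inter> power_image (carrier G))"
    by (auto simp: layer_rank_def layer_def)
  have int: "H \<inter> power_image (carrier G) = power_image K"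
    using Int_power_image H(2) by simp
  have "H \<subseteq> K"
    using H(1) subgroup_nat_pow_closed[OF H(1)] unfolding H(2)[symmetric]
    by (auto simp: power_preimage_def subgroup.mem_carrier)
  then show "H \<in> trivial_meet_subgroups (power_image K) (K \<inter> power_image (carrier G)) K k"
    using H int by (auto simp: trivial_meet_subgroups_def)
next
  have subK: "subgroup K G" using K by (simp add: layer_def)
  interpret K: subgroup K G by (rule subK)
  fix X assume "X \<in> trivial_meet_subgroups (power_image K) (K \<inter> power_image (carrier G)) K k"
  then have X: "subgroup X G" "power_image K \<subseteq> X" "X \<subseteq> K"
      "X \<inter> (K \<inter> power_image (carrier G)) = power_image K" "card X = p ^ k * card (power_image K)"
    by (auto simp: trivial_meet_subgroups_def)
  have int: "X \<inter> power_image (carrier G) = power_image K" using X(3,4) by auto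
  have "x [^] (p ^ Suc j) \<in> X" if "x \<in> carrier G" for x
  proof -
    have "x [^] (p ^ Suc j) = (x [^] (p ^ j)) [^] p"
      using that by (simp add: nat_pow_pow mult.commute)
    then show ?thesis using K that X(2) by (auto simp: power_image_def layer_def)
  qed
  then have "X \<in> layer_rank (Suc j) k"
    using X int by (simp add: layer_rank_def layer_def)
  moreover have "power_preimage X = K"
  proof (intro equalityI subsetI)
    fix x assume "x \<in> power_preimage X"
    then have x: "x \<in> carrier G" "x [^] p \<in> X" by (auto simp: power_preimage_def)
    then have "x [^] p \<in> power_image K"
      unfolding int[symmetric] by (auto simp: power_image_def)
    then obtain y where y: "y \<in> K" "x [^] p = y [^] p" by (auto simp: power_image_def)
    have "(x \<otimes> inv y) [^] p = \<one>"
      using x y by (simp add: nat_pow_distrib nat_pow_inv)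
    then have "x \<otimes> inv y \<in> K"
      using torsion_subset_layer[OF K j] x y by simp
    then have "x \<otimes> inv y \<otimes> y \<in> K" using y by simp
    then show "x \<in> K" using x y by (simp add: m_assoc)
  next
    fix x assume "x \<in> K"
    then show "x \<in> power_preimage X" using X(2) by (auto simp: power_preimage_def power_image_def)
  qed
  ultimately show "X \<in> {H \<in> layer_rank (Suc j) k. power_preimage H = K}" by simp
qed

text \<open>In the quotient of \<open>K\<close> by its p-th powers, of dimension \<open>r\<close>,
  the fixed subspace has dimension \<open>r - b\<close>. The double count then has factors
  \<open>a * (q ^ k - q ^ i)\<close> on one side and
  \<open>a * q ^ (r - b) * (q ^ b - q ^ i)\<close> on the other, and the product formula for
  Gaussian binomials gives the quotient.\<close>

lemma card_layer_rank_fibre: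
  assumes K: "K \<in> layer_rank j b" and j: "j < e"
  shows "card {H \<in> layer_rank (Suc j) k. power_preimage H = K} =
    p ^ ((r - b) * k) * gauss_binomial p b k"
proof -
  let ?A = "power_image K" and ?Y = "K \<inter> power_image (carrier G)"
  have Kl: "K \<in> layer j" and cb: "card K = p ^ b * card ?Y"
    using K by (auto simp: layer_rank_def)
  have subK: "subgroup K G" using Kl by (simp add: layer_def)
  note subA = subgroup_power_image[OF subK]
  have subY: "subgroup ?Y G"
    using subgroups_Inter_pair subK subgroup_power_image(1)[OF subgroup_self] by blast
  have AY: "?A \<subseteq> ?Y"
    using subA(2) subgroup.mem_carrier[OF subK] by (auto simp: power_image_def)
  have eA: "elementary_over ?A K"
    using subA subK by (auto simp: elementary_over_def power_image_def)
  have eY: "elementary_over ?Y K"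
    using elementary_over_mid(1)[OF eA subY AY] by simp
  have cr: "card K = p ^ r * card ?A" using card_power_image[OF Kl j] .
  have Apos: "card ?A > 0" and Ypos: "card ?Y > 0"
    using card_subgroup_pos subA(1) subY by auto
  have "p ^ b * card ?Y = p ^ r * card ?A" using cb cr by simp
  also have "\<dots> \<le> p ^ r * card ?Y"
    using card_mono[OF finite_subgroup[OF subY] AY] by (rule mult_le_mono2)
  finally have "p ^ b * card ?Y \<le> p ^ r * card ?Y" .
  then have br: "b \<le> r" using Ypos p_gt_1 by simp
  have "p ^ b * card ?Y = p ^ b * (p ^ (r - b) * card ?A)"
    using cb cr br by (simp add: mult.assoc[symmetric] power_add[symmetric])
  then have cY: "card ?Y = p ^ (r - b) * card ?A"
    using p_gt_1 by simp
  define a where "a = int (card ?A)"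
  define q where "q = int p"
  have a0: "a \<noteq> 0" and q1: "q > 1" using Apos p_gt_1 by (auto simp: a_def q_def)
  let ?N = "trivial_meet_subgroups ?A ?Y K k"
  let ?Q = "\<lambda>n::nat. \<Prod>i<k. q ^ n - q ^ i"
  have "int (card ?N) * int (\<Prod>i<k. p ^ k * card ?A - p ^ i * card ?A) =
      int (\<Prod>i<k. card K - p ^ i * card ?Y)"
    using card_trivial_meet_subgroups[OF eA eY AY, of k] by (metis of_nat_mult)
  also have "int (\<Prod>i<k. p ^ k * card ?A - p ^ i * card ?A) = (\<Prod>i<k. a * (q ^ k - q ^ i))"
    unfolding of_nat_prod
  proof (rule prod.cong[OF refl])
    fix i assume "i \<in> {..<k}"
    then have "p ^ i * card ?A \<le> p ^ k * card ?A"
      using p_gt_1 by (intro mult_right_mono power_increasing) auto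
    then show "int (p ^ k * card ?A - p ^ i * card ?A) = a * (q ^ k - q ^ i)"
      by (simp add: of_nat_diff a_def q_def algebra_simps)
  qed
  \<comment> \<open>Truncated subtraction agrees with integer subtraction as long as
    \<open>i \<le> b\<close>. If \<open>b < k\<close>, single factors may differ, but both products
    vanish at \<open>i = b\<close>.\<close>
  also have "int (\<Prod>i<k. card K - p ^ i * card ?Y) = (\<Prod>i<k. a * q ^ (r - b) * (q ^ b - q ^ i))"
  proof (cases "b < k")
    case True
    have "(\<Prod>i<k. card K - p ^ i * card ?Y) = 0"
      using True cb by (auto intro!: prod_zero bexI[of _ b])
    moreover have "(\<Prod>i<k. a * q ^ (r - b) * (q ^ b - q ^ i)) = 0"
      using True by (auto intro!: prod_zero bexI[of _ b])
    ultimately show ?thesis by (simp only: of_nat_0)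
  next
    case False
    show ?thesis
      unfolding of_nat_prod
    proof (rule prod.cong[OF refl])
      fix i assume "i \<in> {..<k}"
      then have "p ^ i * card ?Y \<le> p ^ b * card ?Y"
        using p_gt_1 False by (intro mult_right_mono power_increasing) auto
      then show "int (card K - p ^ i * card ?Y) = a * q ^ (r - b) * (q ^ b - q ^ i)"
        unfolding cb by (simp add: of_nat_diff a_def q_def cY algebra_simps)
    qed
  qed
  finally have "int (card ?N) * (a ^ k * ?Q k) = a ^ k * q ^ ((r - b) * k) * ?Q b"
    by (simp add: prod.distrib power_mult_distrib power_mult)
  also have "?Q b = gauss_binomial q b k * ?Q k"
    by (rule gauss_binomial_prod[symmetric])
  finally have "int (card ?N) * (a ^ k * ?Q k) =
      (q ^ ((r - b) * k) * gauss_binomial q b k) * (a ^ k * ?Q k)"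
    by (simp add: mult_ac)
  moreover have "a ^ k * ?Q k \<noteq> 0"
    using a0 q1 by (auto simp: power_inject_exp)
  ultimately have "int (card ?N) = q ^ ((r - b) * k) * gauss_binomial q b k"
    by (simp only: mult_cancel_right) simp
  then have "int (card ?N) = int (p ^ ((r - b) * k) * gauss_binomial p b k)"
    by (simp add: q_def of_nat_gauss_binomial)
  then show ?thesis
    unfolding layer_rank_fibre[OF Kl j] by (simp only: of_nat_eq_iff)
qed

section \<open>Sorting the layers by rank\<close>

lemma layer_0: "layer 0 = {carrier G}"
  using subgroup_self by (auto simp: layer_def dest: subgroup.mem_carrier)

lemma finite_layer: "finite (layer j)"
  by (rule finite_subset[of _ "Pow (carrier G)"])
    (auto simp: layer_def finite_carrier dest: subgroup.mem_carrier)

lemma finite_layer_rank: "finite (layer_rank j k)"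
  by (rule finite_subset[OF _ finite_layer[of j]]) (auto simp: layer_rank_def)

lemma layer_rank_disjoint:
  assumes "H \<in> layer_rank j b" "H \<in> layer_rank j c"
  shows "b = c"
proof -
  have "subgroup (H \<inter> power_image (carrier G)) G"
    using subgroups_Inter_pair subgroup_power_image(1)[OF subgroup_self] assms
    by (auto simp: layer_rank_def layer_def)
  from card_subgroup_pos[OF this] show ?thesis
    using assms p_gt_1 by (auto simp: layer_rank_def)
qed

lemma layer_0_rank:
  assumes "e > 0"
  shows "carrier G \<in> layer_rank 0 r"
proof -
  have "carrier G \<inter> power_image (carrier G) = power_image (carrier G)"
    by (auto simp: power_image_def)
  then show ?thesis
    using card_power_image[of "carrier G" 0] assms by (simp add: layer_rank_def layer_0)
qed

text \<open>For positive \<open>j\<close>, \<open>H\<close> lies between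
  \<open>power_image K\<close> and \<open>K\<close>, where \<open>K\<close> is its preimage. The
  index of the former in the latter is \<open>p ^ r\<close>, so the index of
  \<open>power_image K\<close> in \<open>H\<close> divides it and is a power of \<open>p\<close>
  with exponent at most \<open>r\<close>.\<close>

lemma layer_eq_UN_layer_rank:
  assumes "j \<le> e" "e > 0"
  shows "layer j = (\<Union>b\<le>r. layer_rank j b)"
proof (cases j)
  case 0
  then show ?thesis using layer_0_rank[OF assms(2)] by (auto simp: layer_rank_def layer_0)
next
  case (Suc i)
  have "\<exists>b\<le>r. H \<in> layer_rank j b" if H: "H \<in> layer j" for H
  proof -
    let ?K = "power_preimage H"
    have K: "?K \<in> layer i" using power_preimage_layer H Suc by simp
    have sub: "subgroup H G" "subgroup ?K G" "subgroup (power_image ?K) G"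
      using H K subgroup_power_image by (auto simp: layer_def)
    have "card (power_image ?K) dvd card H"
      using sub Int_power_image[of H] by (intro card_subgroup_dvd) auto
    then obtain d where d: "card H = card (power_image ?K) * d" by (rule dvdE)
    have "H \<subseteq> ?K"
      using subgroup_nat_pow_closed[OF sub(1)] subgroup.mem_carrier[OF sub(1)]
      by (auto simp: power_preimage_def)
    then have "card H dvd card ?K" using sub by (intro card_subgroup_dvd) auto
    then have "d dvd p ^ r"
      using card_power_image[OF K] Suc assms card_subgroup_pos[OF sub(3)] d
      by (simp add: mult.commute)
    then obtain b where "b \<le> r" "d = p ^ b"
      using prime_p by (auto simp: divides_primepow_nat)
    then show ?thesis
      using d H by (auto simp: layer_rank_def Int_power_image mult.commute)
  qed
  then show ?thesis by (auto simp: layer_rank_def)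
qed

lemma sum_layer:
  assumes "j \<le> e" "e > 0"
  shows "sum f (layer j) = (\<Sum>b\<le>r. sum f (layer_rank j b))"
  unfolding layer_eq_UN_layer_rank[OF assms]
  using layer_rank_disjoint finite_layer_rank by (intro sum.UNION_disjoint) blast+

text \<open>The subgroups of layer \<open>Suc j\<close> are sorted by their preimage
  \<open>K\<close> in layer \<open>j\<close>, and these by rank; the size of a fibre depends only on
  the rank of \<open>K\<close>.\<close>

lemma card_layer_rank:
  assumes "j \<le> e" "e > 0"
  shows "card (layer_rank j k) = rank_count r p j k"
  using assms(1)
proof (induction j arbitrary: k)
  case 0
  have "layer_rank 0 k \<subseteq> {carrier G}"
    by (auto simp: layer_rank_def layer_0)
  moreover have "carrier G \<in> layer_rank 0 k \<longleftrightarrow> k = r"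
    using layer_0_rank[OF assms(2)] layer_rank_disjoint by blast
  ultimately have "layer_rank 0 k = (if k = r then {carrier G} else {})"
    by (auto simp: subset_singleton_iff)
  then show ?case by simp
next
  case (Suc j)
  then have j: "j < e" by simp
  have "power_preimage ` layer_rank (Suc j) k \<subseteq> layer j"
    using power_preimage_layer unfolding layer_rank_def by blast
  from sum.group[OF finite_layer_rank finite_layer this, of "\<lambda>_. 1::nat"]
  have "card (layer_rank (Suc j) k) =
      (\<Sum>K\<in>layer j. card {H \<in> layer_rank (Suc j) k. power_preimage H = K})"
    by simp
  also have "\<dots> = (\<Sum>b\<le>r. \<Sum>K\<in>layer_rank j b.
      card {H \<in> layer_rank (Suc j) k. power_preimage H = K})"
    using j assms(2) by (intro sum_layer) auto
  also have "\<dots> = (\<Sum>b\<le>r. \<Sum>K\<in>layer_rank j b. p ^ ((r - b) * k) * gauss_binomial p b k)"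
    using card_layer_rank_fibre j by (intro sum.cong) auto
  also have "\<dots> = rank_count r p (Suc j) k"
    using Suc by simp
  finally show ?case .
qed

lemma card_subgroups:
  assumes "e > 0"
  shows "card {H. subgroup H G} = (\<Sum>k\<le>r. rank_count r p e k)"
proof -
  have "{H. subgroup H G} = layer e"
    using exponent by (auto simp: layer_def subgroup.one_closed)
  then show ?thesis
    using sum_layer[of e "\<lambda>_. 1::nat"] card_layer_rank assms by simp
qed

end

section \<open>Homocyclic groups as products of cyclic groups\<close>

lemma nat_pow_DirProd:
  "x [^]\<^bsub>G \<times>\<times> H\<^esub> (n::nat) = (fst x [^]\<^bsub>G\<^esub> n, snd x [^]\<^bsub>H\<^esub> n)"
  by (induction n) (simp_all add: mult_DirProd')

lemma homocyclic_group_DirProd: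
  assumes "homocyclic_group G p e r" "homocyclic_group H p e s"
  shows "homocyclic_group (G \<times>\<times> H) p e (r + s)"
proof -
  interpret G: homocyclic_group G p e r by (rule assms(1))
  interpret H: homocyclic_group H p e s by (rule assms(2))
  interpret GH: group "G \<times>\<times> H"
    by (rule DirProd_group[OF G.is_group H.is_group])
  show ?thesis
  proof (intro homocyclic_group.intro finite_comm_group_prime.intro
      finite_comm_group_prime_axioms.intro homocyclic_group_axioms.intro)
    show "comm_group (G \<times>\<times> H)"
      by (rule GH.group_comm_groupI) (auto simp: G.m_comm H.m_comm)
    show "finite (carrier (G \<times>\<times> H))"
      using G.finite_carrier H.finite_carrier by simp
    show "prime p" by (rule G.prime_p)
  next
    fix x assume "x \<in> carrier (G \<times>\<times> H)"
    then show "x [^]\<^bsub>G \<times>\<times> H\<^esub> (p ^ e) = \<one>\<^bsub>G \<times>\<times> H\<^esub>"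
      using G.exponent H.exponent by (auto simp: nat_pow_DirProd)
  next
    have "{x \<in> carrier (G \<times>\<times> H). x [^]\<^bsub>G \<times>\<times> H\<^esub> p = \<one>\<^bsub>G \<times>\<times> H\<^esub>} =
        {x \<in> carrier G. x [^]\<^bsub>G\<^esub> p = \<one>\<^bsub>G\<^esub>} \<times> {x \<in> carrier H. x [^]\<^bsub>H\<^esub> p = \<one>\<^bsub>H\<^esub>}"
      by (auto simp: nat_pow_DirProd)
    then show "card {x \<in> carrier (G \<times>\<times> H). x [^]\<^bsub>G \<times>\<times> H\<^esub> p = \<one>\<^bsub>G \<times>\<times> H\<^esub>} = p ^ (r + s)"
      by (simp add: card_cartesian_product G.card_torsion H.card_torsion power_add)
  next
    fix x assume "x \<in> carrier (G \<times>\<times> H)" "x [^]\<^bsub>G \<times>\<times> H\<^esub> p = \<one>\<^bsub>G \<times>\<times> H\<^esub>"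
    then have x: "fst x \<in> carrier G" "snd x \<in> carrier H"
        "fst x [^]\<^bsub>G\<^esub> p = \<one>\<^bsub>G\<^esub>" "snd x [^]\<^bsub>H\<^esub> p = \<one>\<^bsub>H\<^esub>"
      by (auto simp: nat_pow_DirProd)
    obtain y z where "y \<in> carrier G" "fst x = y [^]\<^bsub>G\<^esub> (p ^ (e - 1))"
        "z \<in> carrier H" "snd x = z [^]\<^bsub>H\<^esub> (p ^ (e - 1))"
      using G.torsion_divisible[OF x(1,3)] H.torsion_divisible[OF x(2,4)] by blast
    then show "\<exists>y\<in>carrier (G \<times>\<times> H). x = y [^]\<^bsub>G \<times>\<times> H\<^esub> (p ^ (e - 1))"
      by (intro bexI[of _ "(y, z)"]) (auto simp: nat_pow_DirProd prod_eq_iff)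
  qed
qed

text \<open>The \<open>p\<close>-torsion of the cyclic group consists of the \<open>p\<close>
  residues \<open>int p ^ (e - 1) * c\<close> with \<open>c\<close> from 0 to
  \<open>p - 1\<close>.\<close>

lemma homocyclic_group_integer_mod_group:
  assumes p: "prime p" and e: "e > 0"
  shows "homocyclic_group (integer_mod_group (p ^ e)) p e 1"
proof -
  have p0: "p > 0" using p by (rule prime_gt_0_nat)
  have pe: "int p ^ e = int p * int p ^ (e - 1)" using e by (cases e) auto
  have car: "carrier (integer_mod_group (p ^ e)) = {0..<int p ^ e}"
    using p0 by (simp add: carrier_integer_mod_group)
  have tors: "\<exists>c\<in>{0..<int p}. x = int p ^ (e - 1) * c"
    if x: "x \<in> {0..<int p ^ e}" and px: "(int p * x) mod int p ^ e = 0" for x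
  proof -
    have "int p * int p ^ (e - 1) dvd int p * x" using px pe by (simp add: mod_eq_0_iff_dvd)
    then have "int p ^ (e - 1) dvd x" using p0 by simp
    then obtain c where c: "x = int p ^ (e - 1) * c" by (rule dvdE)
    define d where "d = int p ^ (e - 1)"
    have "d > 0" using p0 by (simp add: d_def)
    moreover have "0 \<le> d * c" "d * c < d * int p"
      using x c pe by (auto simp: d_def mult.commute)
    ultimately have "c \<in> {0..<int p}"
      by (auto simp: zero_le_mult_iff)
    then show ?thesis using c by blast
  qed
  show ?thesis
  proof (intro homocyclic_group.intro finite_comm_group_prime.intro
      finite_comm_group_prime_axioms.intro homocyclic_group_axioms.intro)
    have "{x \<in> carrier (integer_mod_group (p ^ e)). x [^]\<^bsub>integer_mod_group (p ^ e)\<^esub> p =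
        \<one>\<^bsub>integer_mod_group (p ^ e)\<^esub>} = (\<lambda>c. int p ^ (e - 1) * c) ` {0..<int p}"
    proof (intro equalityI subsetI)
      fix x assume "x \<in> (\<lambda>c. int p ^ (e - 1) * c) ` {0..<int p}"
      then obtain c where c: "c \<in> {0..<int p}" "x = int p ^ (e - 1) * c" by blast
      then have "int p * x = int p ^ e * c" using pe by simp
      then have "(int p * x) mod int p ^ e = 0" by simp
      moreover have "x \<in> {0..<int p ^ e}" using c p0 unfolding pe by simp
      ultimately show "x \<in> {x \<in> carrier (integer_mod_group (p ^ e)).
          x [^]\<^bsub>integer_mod_group (p ^ e)\<^esub> p = \<one>\<^bsub>integer_mod_group (p ^ e)\<^esub>}"
        by (simp add: car)
    qed (use tors in \<open>force simp: car\<close>)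
    moreover have "inj_on (\<lambda>c. int p ^ (e - 1) * c) {0..<int p}"
      using p0 by (auto intro: inj_onI)
    ultimately show "card {x \<in> carrier (integer_mod_group (p ^ e)).
        x [^]\<^bsub>integer_mod_group (p ^ e)\<^esub> p = \<one>\<^bsub>integer_mod_group (p ^ e)\<^esub>} = p ^ 1"
      by (simp add: card_image)
  next
    fix x assume "x \<in> carrier (integer_mod_group (p ^ e))"
      "x [^]\<^bsub>integer_mod_group (p ^ e)\<^esub> p = \<one>\<^bsub>integer_mod_group (p ^ e)\<^esub>"
    then have x: "x \<in> {0..<int p ^ e}" "(int p * x) mod int p ^ e = 0" by (auto simp: car)
    then obtain c where c: "c \<in> {0..<int p}" "x = int p ^ (e - 1) * c" using tors[OF x] by blast
    \<comment> \<open>Since \<open>e > 0\<close>, the cofactor \<open>c\<close> is itself a residue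
      modulo \<open>p ^ e\<close> and can serve as the witness for divisibility.\<close>
    have "int p \<le> int p ^ e" using p0 e by (intro self_le_power) auto
    then have "c \<in> {0..<int p ^ e}" using c(1) unfolding atLeastLessThan_iff by linarith
    then show "\<exists>y\<in>carrier (integer_mod_group (p ^ e)).
        x = y [^]\<^bsub>integer_mod_group (p ^ e)\<^esub> (p ^ (e - 1))"
      using c(2) x(1) by (intro bexI[of _ c]) (simp_all add: car)
  qed (use p in \<open>auto simp: car\<close>)
qed

lemma homocyclic_group_homocyclic4:
  assumes "prime p" "m > 0"
  shows "homocyclic_group (homocyclic4 p m) p m 4"
proof -
  note C = homocyclic_group_integer_mod_group[OF assms]
  show ?thesis
    using homocyclic_group_DirProd[OF C homocyclic_group_DirProd[OF C homocyclic_group_DirProd[OF C C]]]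
    by (simp add: homocyclic4_def eval_nat_numeral)
qed

section \<open>Subgroup counts of the rank four group\<close>

lemma card_homocyclic4: "prime p \<Longrightarrow> card (carrier (homocyclic4 p m)) = p ^ (4 * m)"
  by (simp add: homocyclic4_def carrier_integer_mod_group prime_gt_0_nat card_cartesian_product
      nat_power_eq flip: power_add) (simp add: mult.commute numeral_Bit0)

lemma subgroups_count_rank_count:
  assumes "prime p" "m > 0"
  shows "subgroups_count p m = (\<Sum>k\<le>4. rank_count 4 p m k)"
proof -
  interpret homocyclic_group "homocyclic4 p m" p m 4
    by (rule homocyclic_group_homocyclic4[OF assms])
  show ?thesis
    using card_subgroups[OF assms(2)] by (simp add: subgroups_count_def)
qed

text \<open>By Lagrange every subgroup order divides \<open>p ^ (4 * m)\<close>, so it is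
  \<open>p ^ b\<close> for exactly one \<open>b\<close> in the range.\<close>

lemma subgroups_count_eq_sum:
  assumes "prime p" "m > 0"
  shows "subgroups_count p m = (\<Sum>b = 0..4 * m. subgroups_of_order_count p m b)"
proof -
  interpret homocyclic_group "homocyclic4 p m" p m 4
    by (rule homocyclic_group_homocyclic4[OF assms])
  let ?S = "{H. subgroup H (homocyclic4 p m)}"
  have fin: "finite ?S"
    by (rule finite_subset[of _ "Pow (carrier (homocyclic4 p m))"])
      (auto simp: finite_carrier dest: subgroup.mem_carrier)
  have "\<exists>b\<le>4 * m. card H = p ^ b" if "subgroup H (homocyclic4 p m)" for H
  proof -
    have "card H dvd p ^ (4 * m)"
      using card_subgroup_dvd[OF that subgroup_self subgroup.subset[OF that]]
      by (simp add: card_homocyclic4 assms(1))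
    then show ?thesis using assms(1) by (simp add: divides_primepow_nat)
  qed
  then have "?S = (\<Union>b\<in>{0..4 * m}. {H. subgroup H (homocyclic4 p m) \<and> card H = p ^ b})"
    by (auto simp: Bex_def)
  then have "card ?S = card (\<Union>b\<in>{0..4 * m}. {H. subgroup H (homocyclic4 p m) \<and> card H = p ^ b})"
    by (rule arg_cong)
  also have "\<dots> = (\<Sum>b = 0..4 * m. card {H. subgroup H (homocyclic4 p m) \<and> card H = p ^ b})"
    using finite_subset[OF _ fin] p_gt_1 by (intro card_UN_disjoint) auto
  finally show ?thesis
    by (simp add: subgroups_count_def subgroups_of_order_count_def)
qed

text \<open>The coefficients are \<open>q ^ ((4 - b) * k) * gauss_binomial q b k\<close>, which
  vanish for \<open>k > b\<close>; hence the system is triangular. For \<open>k = 0\<close> they all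
  equal 1, so the new rank 0 value is the previous total.\<close>

lemma rank_count_4_Suc:
  fixes q :: "'a::comm_semiring_1"
  shows "rank_count 4 q (Suc j) 4 = rank_count 4 q j 4"
    and "rank_count 4 q (Suc j) 3 = q ^ 3 * rank_count 4 q j 3 + (1 + q + q ^ 2 + q ^ 3) * rank_count 4 q j 4"
    and "rank_count 4 q (Suc j) 2 = q ^ 4 * rank_count 4 q j 2 +
      q ^ 2 * (1 + q + q ^ 2) * rank_count 4 q j 3 + (1 + q ^ 2) * (1 + q + q ^ 2) * rank_count 4 q j 4"
    and "rank_count 4 q (Suc j) (Suc 0) = q ^ 3 * rank_count 4 q j (Suc 0) + q ^ 2 * (1 + q) * rank_count 4 q j 2 +
      q * (1 + q + q ^ 2) * rank_count 4 q j 3 + (1 + q + q ^ 2 + q ^ 3) * rank_count 4 q j 4"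
    and "rank_count 4 q (Suc j) 0 = (\<Sum>k\<le>4. rank_count 4 q j k)"
  by (simp_all add: numeral_eq_Suc algebra_simps)

section \<open>Closed form and degree\<close>

text \<open>The triangular system is solved from rank 4 downwards, with denominators cleared. The
  term with \<open>real j\<close> at rank 1 arises because the eigenvalue \<open>q ^ 3\<close> of
  rank 3 recurs there.\<close>

lemma rank_count_4_closed_form:
  fixes q :: real
  assumes "q > 1"
  defines "X \<equiv> \<lambda>j. q ^ j"
  shows "rank_count 4 q j 4 = 1"
    and "(q ^ 3 - 1) * rank_count 4 q j 3 = (1 + q + q ^ 2 + q ^ 3) * (X j ^ 3 - 1)"
    and "q * (q - 1) ^ 2 * (q + 1) * rank_count 4 q j 2 =
      (1 + q ^ 2) * ((1 + q + q ^ 2) * X j ^ 4 - (1 + q) ^ 2 * X j ^ 3 + q)"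
    and "q ^ 2 * (q - 1) ^ 2 * (q ^ 3 - 1) * rank_count 4 q j 1 =
      (1 + q ^ 2) * ((1 + q + q ^ 2) ^ 2 * X j ^ 4 + (q ^ 2 - (1 + q + q ^ 2) ^ 2) * X j ^ 3
        - 2 * (1 + q) * (q ^ 3 - 1) * real j * X j ^ 3 - q ^ 2)"
proof -
  show f4: "rank_count 4 q j 4 = 1" for j
    by (induction j) (simp_all only: rank_count_4_Suc, simp)
  have XS: "X (Suc j) = q * X j" for j by (simp add: X_def)
  show f3: "(q ^ 3 - 1) * rank_count 4 q j 3 = (1 + q + q ^ 2 + q ^ 3) * (X j ^ 3 - 1)" for j
  proof (induction j)
    case 0
    then show ?case by (simp add: X_def)
  next
    case (Suc j)
    then show ?case unfolding rank_count_4_Suc f4 XS by algebra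
  qed
  show f2: "q * (q - 1) ^ 2 * (q + 1) * rank_count 4 q j 2 =
      (1 + q ^ 2) * ((1 + q + q ^ 2) * X j ^ 4 - (1 + q) ^ 2 * X j ^ 3 + q)" for j
  proof (induction j)
    case 0
    then show ?case by (simp add: X_def) algebra
  next
    case (Suc j)
    \<comment> \<open>Factoring \<open>q ^ 3 - 1\<close> isolates the combination of rank 3 that
      enters the recursion for rank 2.\<close>
    have "(q - 1) * ((1 + q + q ^ 2) * rank_count 4 q j 3) =
        (1 + q + q ^ 2 + q ^ 3) * (X j ^ 3 - 1)"
      using f3[of j] by algebra
    with Suc show ?case unfolding rank_count_4_Suc f4 XS by algebra
  qed
  show "q ^ 2 * (q - 1) ^ 2 * (q ^ 3 - 1) * rank_count 4 q j 1 =
      (1 + q ^ 2) * ((1 + q + q ^ 2) ^ 2 * X j ^ 4 + (q ^ 2 - (1 + q + q ^ 2) ^ 2) * X j ^ 3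
        - 2 * (1 + q) * (q ^ 3 - 1) * real j * X j ^ 3 - q ^ 2)" for j
    unfolding One_nat_def
  proof (induction j)
    case 0
    then show ?case by (simp add: X_def)
  next
    case (Suc j)
    have S: "real (Suc j) = real j + 1" by simp
    \<comment> \<open>The recursion is multiplied out and regrouped so that each rank appears
      together with its own clearing factor, ready for substitution of the closed forms.\<close>
    have "q ^ 2 * (q - 1) ^ 2 * (q ^ 3 - 1) * rank_count 4 q (Suc j) (Suc 0) =
        q ^ 3 * (q ^ 2 * (q - 1) ^ 2 * (q ^ 3 - 1) * rank_count 4 q j (Suc 0))
        + q ^ 3 * (q ^ 3 - 1) * (q * (q - 1) ^ 2 * (q + 1) * rank_count 4 q j 2)
        + q ^ 3 * (q - 1) ^ 2 * (1 + q + q ^ 2) * ((q ^ 3 - 1) * rank_count 4 q j 3)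
        + q ^ 2 * (q - 1) ^ 2 * (q ^ 3 - 1) * (1 + q + q ^ 2 + q ^ 3)"
      unfolding rank_count_4_Suc f4 by algebra
    then show ?case unfolding Suc f2 f3 XS S by algebra
  qed
qed

text \<open>The common numerator of the claimed formula, with \<open>X\<close> standing for
  \<open>q ^ m\<close>: separate variables turn the induction step into a polynomial
  identity.\<close>

definition total_numerator :: "real \<Rightarrow> real \<Rightarrow> real \<Rightarrow> real" where
  "total_numerator q X m = (q ^ 2 + q + 1) ^ 3 * (q ^ 2 + 1) * (X ^ 4 * q ^ 2)
    - ((2 * m + 3) * q ^ 3 - 2 * m - 1) * (q ^ 3 + q) * (q + 1) ^ 3 * X ^ 3
    - (4 * m * q ^ 4 + 4 * m * q ^ 3 + 7 * q ^ 4 + 9 * q ^ 3 - 4 * m * q + 6 * q ^ 2 - 4 * m + q - 1)"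

lemma sum_atMost_4:
  fixes f :: "nat \<Rightarrow> 'a::comm_monoid_add"
  shows "(\<Sum>k\<le>4. f k) = f 0 + f (Suc 0) + f 2 + f 3 + f 4"
  by (simp add: eval_nat_numeral)

text \<open>Rank 0 at \<open>Suc j\<close> is the total at \<open>j\<close>, so the induction
  hypothesis supplies it, and the other four ranks have closed forms. No separate closed form for
  rank 0 is involved.\<close>

lemma sum_rank_count_4_closed_form:
  fixes q :: real
  assumes q: "q > 1"
  shows "(q ^ 2 - 1) ^ 2 * (q ^ 3 - 1) ^ 2 * (\<Sum>k\<le>4. rank_count 4 q j k) =
    total_numerator q (q ^ j) (real j)"
proof (induction j)
  case 0
  then show ?case unfolding total_numerator_def sum_atMost_4 by simp algebra
next
  case (Suc j)
  note closed = rank_count_4_closed_form[OF q, of "Suc j", unfolded One_nat_def]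
  define x f1 f2 f3 f0 n where "x = q ^ Suc j" and "f1 = rank_count 4 q (Suc j) (Suc 0)"
    and "f2 = rank_count 4 q (Suc j) 2" and "f3 = rank_count 4 q (Suc j) 3"
    and "f0 = (\<Sum>k\<le>4. rank_count 4 q j k)" and "n = real (Suc j)"
  define y where "y = q ^ j"
  have xy: "x = q * y" by (simp add: x_def y_def)
  have nj: "real j = n - 1" by (simp add: n_def)
  have F: "(q ^ 3 - 1) * f3 = (1 + q + q ^ 2 + q ^ 3) * (x ^ 3 - 1)"
    "q * (q - 1) ^ 2 * (q + 1) * f2 =
      (1 + q ^ 2) * ((1 + q + q ^ 2) * x ^ 4 - (1 + q) ^ 2 * x ^ 3 + q)"
    "q ^ 2 * (q - 1) ^ 2 * (q ^ 3 - 1) * f1 =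
      (1 + q ^ 2) * ((1 + q + q ^ 2) ^ 2 * x ^ 4 + (q ^ 2 - (1 + q + q ^ 2) ^ 2) * x ^ 3
        - 2 * (1 + q) * (q ^ 3 - 1) * n * x ^ 3 - q ^ 2)"
    using closed(2-4) by (simp_all only: f1_def f2_def f3_def x_def n_def)
  let ?D = "(q ^ 2 - 1) ^ 2 * (q ^ 3 - 1) ^ 2"
  have IH: "?D * f0 = total_numerator q y (n - 1)"
    using Suc.IH by (simp only: f0_def y_def nj)
  have d3: "?D * f3 = (q ^ 2 - 1) ^ 2 * (q ^ 3 - 1) * ((q ^ 3 - 1) * f3)" by algebra
  have d2: "q * (?D * f2) = (q + 1) * (q ^ 3 - 1) ^ 2 * (q * (q - 1) ^ 2 * (q + 1) * f2)" by algebra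
  have d1: "q ^ 2 * (?D * f1) = (q + 1) ^ 2 * (q ^ 3 - 1) * (q ^ 2 * (q - 1) ^ 2 * (q ^ 3 - 1) * f1)"
    by algebra
  \<comment> \<open>The factor \<open>q ^ 2\<close> clears the powers of \<open>q\<close> in the
    denominators of ranks 1 and 2; it is cancelled at the end.\<close>
  have "q ^ 2 * (?D * (f0 + f1 + f2 + f3 + 1)) =
      q ^ 2 * (?D * f0) + q ^ 2 * (?D * f1) + q * (q * (?D * f2)) + q ^ 2 * (?D * f3) + q ^ 2 * ?D"
    by algebra
  also have "\<dots> = q ^ 2 * total_numerator q x n"
    unfolding d3 d2 d1 F IH total_numerator_def xy by algebra
  finally have "?D * (f0 + f1 + f2 + f3 + 1) = total_numerator q x n"
    using q by simp
  moreover have "(\<Sum>k\<le>4. rank_count 4 q (Suc j) k) = f0 + f1 + f2 + f3 + 1"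
    unfolding sum_atMost_4[of "rank_count 4 q (Suc j)"] closed(1) rank_count_4_Suc(5)
    by (simp only: f0_def f1_def f2_def f3_def)
  ultimately show ?case by (simp only: x_def n_def)
qed

section \<open>Degree and leading coefficient of the counting polynomial\<close>

lemma degree_mult_less:
  fixes a b :: "'a::comm_semiring_0 poly"
  assumes "degree a \<le> i" "degree b < n" "i + n \<le> l"
  shows "degree (a * b) < l"
  using degree_mult_le[of a b] assms by linarith

text \<open>The dominant eigenvalue \<open>q ^ 4\<close> belongs to rank 2 alone, so rank 2 is monic
  of degree \<open>4 * Suc j\<close> and all other ranks stay below. The claims start at
  \<open>Suc j\<close> because rank 2 is zero at step 0.\<close>

lemma degree_rank_count_4:
  fixes j :: nat
  defines "P \<equiv> rank_count 4 [:0, 1:] :: nat \<Rightarrow> nat \<Rightarrow> int poly"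
  shows "P j 4 = 1" "degree (P (Suc j) 3) < 4 * Suc j"
    "degree (P (Suc j) 2) = 4 * Suc j" "lead_coeff (P (Suc j) 2) = 1"
    "degree (P (Suc j) (Suc 0)) < 4 * Suc j" "degree (P (Suc j) 0) < 4 * Suc j"
proof -
  \<comment> \<open>Explicit coefficient lists let the simplifier compute the degrees of the
    recursion coefficients.\<close>
  have coeffs: "[:0, 1:] ^ 3 = ([:0, 0, 0, 1:] :: int poly)" "[:0, 1:] ^ 4 = ([:0, 0, 0, 0, 1:] :: int poly)"
    "1 + [:0, 1:] + [:0, 1:] ^ 2 + [:0, 1:] ^ 3 = ([:1, 1, 1, 1:] :: int poly)"
    "[:0, 1:] ^ 2 * (1 + [:0, 1:] + [:0, 1:] ^ 2) = ([:0, 0, 1, 1, 1:] :: int poly)"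
    "(1 + [:0, 1:] ^ 2) * (1 + [:0, 1:] + [:0, 1:] ^ 2) = ([:1, 1, 2, 1, 1:] :: int poly)"
    "[:0, 1:] ^ 2 * (1 + [:0, 1:]) = ([:0, 0, 1, 1:] :: int poly)"
    "[:0, 1:] * (1 + [:0, 1:] + [:0, 1:] ^ 2) = ([:0, 1, 1, 1:] :: int poly)"
    by (simp_all add: eval_nat_numeral one_pCons)
  have rec: "P (Suc j) 4 = P j 4"
    "P (Suc j) 3 = [:0, 0, 0, 1:] * P j 3 + [:1, 1, 1, 1:] * P j 4"
    "P (Suc j) 2 = [:0, 0, 0, 0, 1:] * P j 2 + ([:0, 0, 1, 1, 1:] * P j 3 + [:1, 1, 2, 1, 1:] * P j 4)"
    "P (Suc j) (Suc 0) = [:0, 0, 0, 1:] * P j (Suc 0) + [:0, 0, 1, 1:] * P j 2 +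
      [:0, 1, 1, 1:] * P j 3 + [:1, 1, 1, 1:] * P j 4"
    "P (Suc j) 0 = P j 0 + P j (Suc 0) + P j 2 + P j 3 + P j 4" for j
    unfolding P_def rank_count_4_Suc sum_atMost_4 coeffs(3-7)
    unfolding coeffs(1,2) by (simp_all only: add.assoc)
  show P4: "P j 4 = 1" for j
    by (induction j) (simp_all only: rec, simp add: P_def)
  have "degree (P (Suc j) 3) < 4 * Suc j \<and> degree (P (Suc j) 2) = 4 * Suc j \<and>
    lead_coeff (P (Suc j) 2) = 1 \<and> degree (P (Suc j) (Suc 0)) < 4 * Suc j \<and>
    degree (P (Suc j) 0) < 4 * Suc j"
  proof (induction j)
    case 0
    have "P 0 3 = 0" "P 0 2 = 0" "P 0 (Suc 0) = 0" "P 0 0 = 0" by (simp_all add: P_def)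
    then show ?case by (simp add: rec P4)
  next
    case (Suc j)
    let ?n = "4 * Suc (Suc j)"
    from Suc have IH: "degree (P (Suc j) 3) < 4 * Suc j" "degree (P (Suc j) 2) = 4 * Suc j"
      "lead_coeff (P (Suc j) 2) = 1" "degree (P (Suc j) (Suc 0)) < 4 * Suc j"
      "degree (P (Suc j) 0) < 4 * Suc j" by auto
    note rec' = rec[of "Suc j"]
    have G: "degree ([:0, 0, 1, 1, 1:] * P (Suc j) 3 + [:1, 1, 2, 1, 1:] * P (Suc j) 4) < ?n"
      using IH(1) by (intro degree_add_less degree_mult_less[where i = 4 and n = "4 * Suc j"]) (simp_all add: P4)
    have "P (Suc j) 2 \<noteq> 0" using IH(2) by auto
    then have top: "degree ([:0, 0, 0, 0, 1:] * P (Suc j) 2) = ?n"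
      using IH(2) by (subst degree_mult_eq) auto
    have lead: "lead_coeff ([:0, 0, 0, 0, 1:] * P (Suc j) 2) = 1"
      by (simp only: lead_coeff_mult IH(3)) simp
    have "degree (P (Suc (Suc j)) 3) < ?n"
      unfolding rec' using IH(1)
      by (intro degree_add_less degree_mult_less[where i = 3 and n = "4 * Suc j"]) (simp_all add: P4)
    moreover have "degree (P (Suc (Suc j)) 2) = ?n"
      unfolding rec' using degree_add_eq_left[OF G[folded top]] top by (rule trans)
    moreover have "lead_coeff (P (Suc (Suc j)) 2) = 1"
      unfolding rec' add.commute[of "[:0, 0, 0, 0, 1:] * P (Suc j) 2"]
      using lead_coeff_add_le[OF G[folded top]] lead by (rule trans)
    \<comment> \<open>Rank 2 attains degree \<open>4 * Suc j\<close>, so the strict bound is taken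
      one higher; its coefficient has degree only 3, and the sum is exactly
      \<open>?n\<close>.\<close>
    moreover have "degree (P (Suc (Suc j)) (Suc 0)) < ?n"
      unfolding rec' using IH(1,2,4)
      by (intro degree_add_less degree_mult_less[where i = 3 and n = "4 * Suc j + 1"]) (simp_all add: P4)
    moreover have "degree (P (Suc (Suc j)) 0) < ?n"
      unfolding rec' using IH by (intro degree_add_less) (simp_all add: P4)
    ultimately show ?case by blast
  qed
  then show "degree (P (Suc j) 3) < 4 * Suc j"
    "degree (P (Suc j) 2) = 4 * Suc j" "lead_coeff (P (Suc j) 2) = 1"
    "degree (P (Suc j) (Suc 0)) < 4 * Suc j" "degree (P (Suc j) 0) < 4 * Suc j"
    by auto
qed

lemma sum_rank_count_4_monic:
  assumes "m > 0"
  defines "P \<equiv> (\<Sum>k\<le>4. rank_count 4 [:0, 1:] m k) :: int poly"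
  shows "degree P = 4 * m" "lead_coeff P = 1"
proof -
  obtain j where m: "m = Suc j" using assms(1) by (cases m) auto
  let ?R = "\<lambda>k. rank_count 4 [:0, 1:] m k :: int poly"
  have P: "P = (?R 0 + ?R (Suc 0) + ?R 3 + ?R 4) + ?R 2"
    by (simp add: P_def sum_atMost_4)
  note d = degree_rank_count_4[of j, folded m]
  have R4: "?R 4 = 1" unfolding m by (rule degree_rank_count_4(1))
  have low: "degree (?R 0 + ?R (Suc 0) + ?R 3 + ?R 4) < degree (?R 2)"
    unfolding d(3) R4 using d(2,5,6) assms(1) by (intro degree_add_less) auto
  show "degree P = 4 * m"
    unfolding P using degree_add_eq_right[OF low] d(3) by simp
  show "lead_coeff P = 1"
    unfolding P using lead_coeff_add_le[OF low] d(4) by simp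
qed

text \<open>The polynomial is the recursion run at the indeterminate. It is chosen before
  \<open>p\<close>, so one integer polynomial serves all primes.\<close>

theorem theorem3p2:
  fixes m :: nat
  assumes "m \<ge> 1"
  shows "\<exists>P :: int poly. degree P = 4 * m \<and> lead_coeff P = 1 \<and>
    (\<forall>p :: nat. prime p \<longrightarrow>
       subgroups_count p m = (\<Sum>b = 0..4 * m. subgroups_of_order_count p m b) \<and>
       int (subgroups_count p m) = poly P (int p) \<and>
       real (subgroups_count p m) =
         ((real p ^ 2 + real p + 1) ^ 3 * (real p ^ 2 + 1) * real p ^ (4 * m + 2)
            - ((2 * real m + 3) * real p ^ 3 - 2 * real m - 1) * (real p ^ 3 + real p)
                * (real p + 1) ^ 3 * real p ^ (3 * m))
           / ((real p ^ 2 - 1) ^ 2 * (real p ^ 3 - 1) ^ 2)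
         - (4 * real m * real p ^ 4 + 4 * real m * real p ^ 3 + 7 * real p ^ 4 + 9 * real p ^ 3
              - 4 * real m * real p + 6 * real p ^ 2 - 4 * real m + real p - 1)
           / ((real p ^ 2 - 1) ^ 2 * (real p ^ 3 - 1) ^ 2))"
proof (intro exI conjI allI impI)
  have m: "m > 0" using assms by simp
  let ?P = "(\<Sum>k\<le>4. rank_count 4 [:0, 1:] m k) :: int poly"
  show "degree ?P = 4 * m" "lead_coeff ?P = 1"
    using sum_rank_count_4_monic[OF m] by auto
  fix p :: nat assume p: "prime p"
  show "subgroups_count p m = (\<Sum>b = 0..4 * m. subgroups_of_order_count p m b)"
    by (rule subgroups_count_eq_sum[OF p m])
  show "int (subgroups_count p m) = poly ?P (int p)"
    unfolding subgroups_count_rank_count[OF p m]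
    by (simp add: poly_sum poly_rank_count of_nat_rank_count)
  define q where "q = real p"
  have q: "q > 1" using prime_gt_1_nat[OF p] by (simp add: q_def)
  let ?D = "(q ^ 2 - 1) ^ 2 * (q ^ 3 - 1) ^ 2"
  have "q ^ 2 > 1" "q ^ 3 > 1" using q by (simp_all add: one_less_power)
  then have "?D \<noteq> 0" by simp
  moreover have "real (subgroups_count p m) = (\<Sum>k\<le>4. rank_count 4 q m k)"
    unfolding subgroups_count_rank_count[OF p m]
    by (simp add: of_nat_rank_count q_def)
  ultimately have "real (subgroups_count p m) = total_numerator q (q ^ m) (real m) / ?D"
    using sum_rank_count_4_closed_form[OF q, of m] by (simp add: eq_divide_eq mult.commute)
  moreover have "(q ^ m) ^ 4 * q ^ 2 = q ^ (4 * m + 2)" "(q ^ m) ^ 3 = q ^ (3 * m)"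
    by (simp_all only: power_add power_mult[symmetric] mult.commute[of m])
  ultimately show "real (subgroups_count p m) =
         ((real p ^ 2 + real p + 1) ^ 3 * (real p ^ 2 + 1) * real p ^ (4 * m + 2)
            - ((2 * real m + 3) * real p ^ 3 - 2 * real m - 1) * (real p ^ 3 + real p)
                * (real p + 1) ^ 3 * real p ^ (3 * m))
           / ((real p ^ 2 - 1) ^ 2 * (real p ^ 3 - 1) ^ 2)
         - (4 * real m * real p ^ 4 + 4 * real m * real p ^ 3 + 7 * real p ^ 4 + 9 * real p ^ 3
              - 4 * real m * real p + 6 * real p ^ 2 - 4 * real m + real p - 1)
           / ((real p ^ 2 - 1) ^ 2 * (real p ^ 3 - 1) ^ 2)"
    by (simp only: total_numerator_def q_def diff_divide_distrib)
qed

end
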